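(* Let $b_0\in[0,\infty)$. There is no even probability measure $\rho$ on $\mathbb{R}$ with $\mathcal{T}_\rho=(-\infty,b_0]$ such that either $\mathcal{P}_\rho=(-\infty,b_0]$ or $\mathcal{P}_\rho=[\Lambda_0,b_0]$ for some $\Lambda_0\in(-\infty,b_0)$.
   Context: For an even probability measure $\rho$ on $\mathbb{R}$ and $\lambda\in\mathbb{R}$, let $H_{\rho,\lambda}(z)=\int_{-\infty}^{\infty} e^{izt}e^{\lambda t^2}\,d\rho(t)$ for $z\in\mathbb{C}$. Define $\mathcal{T}_\rho=\{b\in\mathbb{R}:\int e^{bx^2}\,d\rho(x)<\infty\}$ and $\mathcal{P}_\rho=\{\lambda\in\mathbb{R}: H_{\rho,\lambda}\text{ is entire and all its zeros in }\mathbb{C}\text{ are real}\}$. *)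

theory Defs
  imports "HOL-Probability.Probability" "HOL-Complex_Analysis.Complex_Analysis"
begin

definition even_prob_measure :: "real measure \<Rightarrow> bool" where
  "even_prob_measure \<rho> \<longleftrightarrow> real_distribution \<rho> \<and> distr \<rho> borel uminus = \<rho>"

definition H_integrand :: "real \<Rightarrow> complex \<Rightarrow> real \<Rightarrow> complex" where
  "H_integrand \<mu> z t = exp (\<i> * z * of_real t) * of_real (exp (\<mu> * t\<^sup>2))"

definition H :: "real measure \<Rightarrow> real \<Rightarrow> complex \<Rightarrow> complex" where
  "H \<rho> \<mu> z = (\<integral>t. H_integrand \<mu> z t \<partial>\<rho>)"

definition T_set :: "real measure \<Rightarrow> real set" where
  "T_set \<rho> = {b. (\<integral>\<^sup>+x. ennreal (exp (b * x\<^sup>2)) \<partial>\<rho>) < \<infinity>}"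

(* The Bochner integral is 0 for non-integrable functions, so holomorphy of the total
   function H alone would not say that the defining integral exists; convergence at
   every z is therefore required explicitly. *)
definition H_entire :: "real measure \<Rightarrow> real \<Rightarrow> bool" where
  "H_entire \<rho> \<mu> \<longleftrightarrow>
     (\<forall>z. integrable \<rho> (H_integrand \<mu> z)) \<and> H \<rho> \<mu> holomorphic_on UNIV"

definition P_set :: "real measure \<Rightarrow> real set" where
  "P_set \<rho> = {\<mu>. H_entire \<rho> \<mu> \<and> (\<forall>z. H \<rho> \<mu> z = 0 \<longrightarrow> z \<in> \<real>)}"

end

(*
  Suppose P contains [l0, b0], and let l0 <= l < b0. Then H_l is entire, even, of order at most 2
  and has only real zeros. Dividing out the zeros of modulus at most R leaves a zero-free function
  on that disc; Borel-Caratheodory bounds the third derivative of its logarithm by O(1/R). Each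
  removed factor satisfies |1 - iy/x| <= exp(y^2/(2 x^2)), which is exactly its second-order Taylor
  term, so R -> infinity gives H_l(iy) <= H_l(0) exp(A y^2) with A = |H_l''(0)| / (2 H_l(0)), and A is
  bounded uniformly in l because H_{b0} converges everywhere. Integrating H_l(iy) against
  exp(-c y^2) with c > A shows that l + 1/(4c) lies in T; for l close to b0 this exceeds b0.
*)
theory Submission imports Defs "HOL-Real_Asymp.Real_Asymp"
begin

section \<open>Borel-Caratheodory estimate on the half disc\<close>

text \<open>The map v -> v / (2 * M - v) fixes 0 and sends the half-plane Re v < M into the unit
  disc. The Schwarz lemma bounds its composite with \<open>h\<close> by 1/2 on the half disc, so 2 *
  |h| <= |2 * M - h| <= 2 * M + |h|.\<close>

lemma borel_caratheodory_half:
  fixes h :: "complex \<Rightarrow> complex"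
  assumes h: "h holomorphic_on ball 0 R" "h 0 = 0"
    and R: "0 < R"
    and Re_less: "\<And>z. z \<in> ball 0 R \<Longrightarrow> Re (h z) < M"
    and z: "norm z \<le> R / 2"
  shows "norm (h z) \<le> 2 * M"
proof -
  have M: "M > 0" using Re_less[of 0] h(2) R by simp
  define \<phi> where "\<phi> \<equiv> \<lambda>w. h (of_real R * w) / (of_real (2 * M) - h (of_real R * w))"
  have Rw: "of_real R * w \<in> ball 0 R" if "norm w < 1" for w :: complex
    using that R by (simp add: norm_mult)
  have nz: "of_real (2 * M) - h (of_real R * w) \<noteq> 0" if "norm w < 1" for w
  proof
    assume "of_real (2 * M) - h (of_real R * w) = 0"
    then have "Re (h (of_real R * w)) = 2 * M" by (metis Re_complex_of_real eq_iff_diff_eq_0)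
    with Re_less[OF Rw[OF that]] M show False by simp
  qed
  have hol: "\<phi> holomorphic_on ball 0 1"
  proof -
    have "(h \<circ> (\<lambda>w. of_real R * w)) holomorphic_on ball 0 1"
      by (rule holomorphic_on_compose_gen[OF _ h(1)]) (use Rw in \<open>auto intro!: holomorphic_intros\<close>)
    then show ?thesis
      unfolding \<phi>_def o_def by (intro holomorphic_intros) (use nz in auto)
  qed
  have less: "norm (\<phi> w) < 1" if "norm w < 1" for w
  proof -
    let ?v = "h (of_real R * w)"
    \<comment> \<open>The difference of the two squares is
      \<open>4 * M * (M - Re ?v)\<close>.\<close>
    have "(norm ?v)\<^sup>2 < (norm (of_real (2 * M) - ?v))\<^sup>2"
    proof -
      have "Re ?v < M" by (rule Re_less[OF Rw[OF that]])
      then have "M * Re ?v < M * M" using M by simp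
      then show ?thesis unfolding cmod_power2 by (simp add: power2_eq_square algebra_simps)
    qed
    then have "norm ?v < norm (of_real (2 * M) - ?v)"
      by (rule power_less_imp_less_base) simp
    then show ?thesis unfolding \<phi>_def norm_divide
      by (subst divide_less_eq_1) (use nz[OF that] in auto)
  qed
  define w where "w = z / of_real R"
  have w: "norm w \<le> 1 / 2" "of_real R * w = z"
    using z R by (auto simp: w_def norm_divide field_simps)
  have "norm (\<phi> w) \<le> norm w"
    by (rule Schwarz_Lemma(1)[OF hol _ less]) (use w h(2) in \<open>auto simp: \<phi>_def\<close>)
  then have "norm (\<phi> w) \<le> 1 / 2" using w by simp
  then have "norm (h z) \<le> norm (of_real (2 * M) - h z) / 2"
    using nz[of w] w unfolding \<phi>_def norm_divide by (simp add: divide_le_eq split: if_splits)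
  also have "\<dots> \<le> (2 * M + norm (h z)) / 2"
    using norm_triangle_ineq4[of "of_real (2 * M)" "h z"] M by simp
  finally show ?thesis by simp
qed

section \<open>Second-order Taylor bounds on the imaginary axis\<close>

definition log_deriv :: "(complex \<Rightarrow> complex) \<Rightarrow> complex \<Rightarrow> complex" where
  "log_deriv f z = deriv f z / f z"

text \<open>Up to \<open>e\<close>, the exponent is the second-order Taylor polynomial of
  \<open>ln (norm (f (\<i> * of_real y) / f 0))\<close> at \<open>y = 0\<close>.\<close>
definition taylor_bounded :: "(complex \<Rightarrow> complex) \<Rightarrow> real \<Rightarrow> real \<Rightarrow> bool" where
  "taylor_bounded f y e \<longleftrightarrow> norm (f (\<i> * of_real y)) \<le>
     norm (f 0) * exp (Re (\<i> * of_real y * log_deriv f 0) - y\<^sup>2 / 2 * Re (deriv (log_deriv f) 0) + e)"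

text \<open>A zero-free \<open>G\<close> has a holomorphic logarithm, whose real part exceeds its
  value at 0 by less than \<open>M\<close>. Borel-Caratheodory turns this one-sided bound into a
  bound on the modulus, Cauchy's inequality then controls the third derivative, and the error term
  is the Taylor remainder.\<close>

lemma taylor_bounded_nonvanishing:
  assumes G: "G holomorphic_on ball 0 R" "\<And>z. z \<in> ball 0 R \<Longrightarrow> G z \<noteq> 0"
    and R: "0 < R"
    and bound: "\<And>z. z \<in> ball 0 R \<Longrightarrow> norm (G z) < norm (G 0) * exp M"
    and y: "\<bar>y\<bar> \<le> R / 4"
  shows "taylor_bounded G y (384 * M * \<bar>y\<bar> ^ 3 / R ^ 3)"
proof -
  obtain g where g: "g holomorphic_on ball 0 R" and exp_g: "\<And>z. z \<in> ball 0 R \<Longrightarrow> exp (g z) = G z"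
    using holomorphic_logarithm_exists[OF convex_ball open_ball G] R by (metis centre_in_ball)
  define h where "h \<equiv> \<lambda>z. g z - g 0"
  have h: "h holomorphic_on ball 0 R" "h 0 = 0"
    unfolding h_def by (auto intro!: holomorphic_intros g)
  have Re_h: "Re (h z) < M" if "z \<in> ball 0 R" for z
  proof -
    have "exp (Re (g z)) < exp (Re (g 0)) * exp M"
      using bound[OF that] exp_g[OF that] exp_g[of 0] R
      by (metis centre_in_ball norm_exp_eq_Re)
    then have "Re (g z) < Re (g 0) + M" by (simp flip: exp_add)
    then show ?thesis by (simp add: h_def)
  qed
  have h_le: "norm (h z) \<le> 2 * M" if "norm z \<le> R / 2" for z
    by (rule borel_caratheodory_half[OF h R Re_h that])
  \<comment> \<open>The circle of radius \<open>R / 4\<close> about \<open>w\<close> stays in the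
    half disc where \<open>h_le\<close> applies, and 768 = 3! * 2 * 4^3.\<close>
  have d3: "norm ((deriv ^^ 3) h w) \<le> 768 * M / R ^ 3" if w: "norm w \<le> R / 4" for w
  proof -
    have "cball w (R / 4) \<subseteq> ball 0 R"
    proof
      fix x assume "x \<in> cball w (R / 4)"
      then show "x \<in> ball 0 R"
        using w R norm_triangle_ineq4[of w "w - x"] by (simp add: dist_norm)
    qed
    then have sub: "h holomorphic_on cball w (R / 4)" using h(1) holomorphic_on_subset by blast
    have "norm ((deriv ^^ 3) h w) \<le> fact 3 * (2 * M) / (R / 4) ^ 3"
    proof (rule Cauchy_inequality)
      show "h holomorphic_on ball w (R / 4)" using sub holomorphic_on_subset ball_subset_cball by blast
      show "continuous_on (cball w (R / 4)) h" using sub by (rule holomorphic_on_imp_continuous_on)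
      show "0 < R / 4" using R by simp
      fix x assume "norm (w - x) = R / 4"
      then show "norm (h x) \<le> 2 * M"
        using w norm_triangle_ineq4[of w "w - x"] by (intro h_le) simp
    qed
    then show ?thesis by (simp add: fact_numeral power_divide)
  qed
  let ?z = "\<i> * of_real y"
  \<comment> \<open>\<open>complex_Taylor\<close> divides the remainder by \<open>fact 2\<close>
    rather than 3!, hence 384 = 768 / 2.\<close>
  have "norm ((deriv ^^ 0) h ?z - (\<Sum>i\<le>2. (deriv ^^ i) h 0 * (?z - 0) ^ i / fact i))
      \<le> (768 * M / R ^ 3) * norm (?z - 0) ^ Suc 2 / fact 2"
  proof (rule complex_Taylor[where S = "cball 0 (R / 4)"])
    fix i :: nat and x :: complex assume x: "x \<in> cball 0 (R / 4)"
    then have "x \<in> ball 0 R" using R by simp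
    then have "((deriv ^^ i) h has_field_derivative (deriv ^^ Suc i) h x) (at x)"
      using holomorphic_derivI[OF holomorphic_higher_deriv[OF h(1)]] by simp
    then show "((deriv ^^ i) h has_field_derivative (deriv ^^ Suc i) h x) (at x within cball 0 (R / 4))"
      by (rule has_field_derivative_at_within)
  next
    fix x :: complex assume "x \<in> cball 0 (R / 4)"
    then have "norm ((deriv ^^ 3) h x) \<le> 768 * M / R ^ 3" using d3 by simp
    then show "norm ((deriv ^^ Suc 2) h x) \<le> 768 * M / R ^ 3" by (simp only: Suc_numeral) (simp add: numeral_3_eq_3)
  qed (use R y in \<open>auto simp: norm_mult\<close>)
  then have taylor: "norm (h ?z - (deriv h 0 * ?z + deriv (deriv h) 0 * ?z\<^sup>2 / 2)) \<le> 384 * M * \<bar>y\<bar> ^ 3 / R ^ 3"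
    using h(2) by (simp add: norm_mult eval_nat_numeral field_simps)
  have deriv_g: "(g has_field_derivative deriv g z) (at z)" if "z \<in> ball 0 R" for z
    using holomorphic_derivI[OF g open_ball that] .
  have ev: "eventually (\<lambda>z. z \<in> ball 0 R) (nhds (0::complex))"
    using R by (intro eventually_nhds_in_open) auto
  have log_deriv_G: "log_deriv G z = deriv g z" if z: "z \<in> ball 0 R" for z
  proof -
    have "eventually (\<lambda>w. w \<in> ball 0 R) (nhds z)"
      using z by (intro eventually_nhds_in_open) auto
    then have "eventually (\<lambda>w. G w = exp (g w)) (nhds z)"
      by eventually_elim (use exp_g in auto)
    then have "deriv G z = deriv (\<lambda>w. exp (g w)) z" by (rule deriv_cong_ev) simp
    also have "\<dots> = exp (g z) * deriv g z"
      by (rule DERIV_imp_deriv) (auto intro!: derivative_eq_intros deriv_g z)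
    finally show ?thesis using exp_g[OF z] by (auto simp: log_deriv_def)
  qed
  have "deriv h z = deriv g z" if "z \<in> ball 0 R" for z
    unfolding h_def by (rule DERIV_imp_deriv) (auto intro!: derivative_eq_intros deriv_g that)
  then have deriv_h: "deriv h z = log_deriv G z" if "z \<in> ball 0 R" for z
    using log_deriv_G that by simp
  have deriv2_h: "deriv (deriv h) 0 = deriv (log_deriv G) 0"
    by (rule deriv_cong_ev) (use eventually_mono[OF ev] deriv_h in auto)
  have "Re (h ?z) - Re (log_deriv G 0 * ?z + deriv (log_deriv G) 0 * ?z\<^sup>2 / 2) \<le> 384 * M * \<bar>y\<bar> ^ 3 / R ^ 3"
    using order_trans[OF complex_Re_le_cmod taylor] deriv_h[of 0] deriv2_h R by simp
  \<comment> \<open>Since \<open>?z\<close> squared is -y^2, the quadratic term changes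
    sign.\<close>
  then have Re_h_le: "Re (h ?z) \<le> Re (?z * log_deriv G 0) - y\<^sup>2 / 2 * Re (deriv (log_deriv G) 0) + 384 * M * \<bar>y\<bar> ^ 3 / R ^ 3"
    by (simp add: power_mult_distrib algebra_simps flip: of_real_power)
  have "norm (G ?z) = exp (Re (g ?z))"
    using exp_g[of ?z] y R norm_exp_eq_Re[of "g ?z"] by (simp add: norm_mult)
  also have "\<dots> = norm (G 0) * exp (Re (h ?z))"
    using exp_g[of 0] R norm_exp_eq_Re[of "g 0"] by (simp add: h_def exp_diff)
  also have "\<dots> \<le> norm (G 0) * exp (Re (?z * log_deriv G 0) - y\<^sup>2 / 2 * Re (deriv (log_deriv G) 0) + 384 * M * \<bar>y\<bar> ^ 3 / R ^ 3)"
    using Re_h_le by (intro mult_left_mono) auto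
  finally show ?thesis unfolding taylor_bounded_def .
qed

text \<open>The factor adds 1 / (z - x) to the logarithmic derivative. At 0 this is the real number
  -1/x, which drops out of the real part after multiplication by iy, and its derivative -1/x^2
  raises the exponent by y^2 / (2 * x^2). That pays for |1 - iy/x|^2 = 1 + y^2/x^2 <= exp (y^2/x^2),
  so \<open>e\<close> is unchanged.\<close>

lemma taylor_bounded_mult_linear:
  fixes x :: real
  assumes f: "f holomorphic_on UNIV" "f 0 \<noteq> 0" and x: "x \<noteq> 0"
    and bounded: "taylor_bounded f y e"
  shows "taylor_bounded (\<lambda>z. (1 - z / of_real x) * f z) y e"
proof -
  let ?F = "\<lambda>z. (1 - z / of_real x) * f z"
  have df: "(f has_field_derivative deriv f z) (at z)" for z
    using holomorphic_derivI[OF f(1)] by simp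
  have "open {z. f z \<noteq> 0}"
    using holomorphic_on_imp_continuous_on[OF f(1)] by (intro open_Collect_neq continuous_on_const) auto
  \<comment> \<open>The formula for \<open>log_deriv ?F\<close> must hold near 0, not only at 0,
    since it is differentiated there.\<close>
  then have "eventually (\<lambda>z. z \<in> {z. f z \<noteq> 0} \<inter> - {of_real x}) (nhds 0)"
    using f x by (intro eventually_nhds_in_open open_Int) (auto simp: open_Compl)
  then have ev: "eventually (\<lambda>z. log_deriv ?F z = 1 / (z - of_real x) + log_deriv f z) (nhds 0)"
  proof eventually_elim
    fix z :: complex assume z: "z \<in> {z. f z \<noteq> 0} \<inter> - {of_real x}"
    have "deriv ?F z = - f z / of_real x + (1 - z / of_real x) * deriv f z"
      by (rule DERIV_imp_deriv) (use x in \<open>auto intro!: derivative_eq_intros df\<close>)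
    then show "log_deriv ?F z = 1 / (z - of_real x) + log_deriv f z"
      using z x by (auto simp: log_deriv_def divide_simps) (simp add: algebra_simps)
  qed
  have 1: "log_deriv ?F 0 = - 1 / of_real x + log_deriv f 0"
    using eventually_nhds_x_imp_x[OF ev] by simp
  have "(log_deriv f has_field_derivative deriv (log_deriv f) 0) (at 0)"
  proof -
    have "((\<lambda>z. deriv f z / f z) has_field_derivative (deriv (deriv f) 0 * f 0 - deriv f 0 * deriv f 0) / (f 0 * f 0)) (at 0)"
      using holomorphic_derivI[OF holomorphic_deriv[OF f(1)]] f(2)
      by (intro DERIV_divide df) auto
    then show ?thesis
      unfolding log_deriv_def[abs_def] using DERIV_imp_deriv by fastforce
  qed
  then have "((\<lambda>z. 1 / (z - of_real x) + log_deriv f z) has_field_derivative - 1 / (of_real x)\<^sup>2 + deriv (log_deriv f) 0) (at 0)"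
    using x by (auto intro!: derivative_eq_intros simp: power2_eq_square)
  then have 2: "deriv (log_deriv ?F) 0 = - 1 / (of_real x)\<^sup>2 + deriv (log_deriv f) 0"
    using deriv_cong_ev[OF ev refl] DERIV_imp_deriv by metis
  have "norm (1 - \<i> * of_real y / of_real x) \<le> exp (y\<^sup>2 / (2 * x\<^sup>2))"
  proof (rule power2_le_imp_le)
    have "(norm (1 - \<i> * of_real y / of_real x))\<^sup>2 = 1 + y\<^sup>2 / x\<^sup>2"
      by (simp add: cmod_power2 power_divide)
    also have "\<dots> \<le> exp (y\<^sup>2 / x\<^sup>2)" by (rule exp_ge_add_one_self)
    finally show "(norm (1 - \<i> * of_real y / of_real x))\<^sup>2 \<le> (exp (y\<^sup>2 / (2 * x\<^sup>2)))\<^sup>2"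
      by (simp flip: exp_double)
  qed simp
  then have "norm (?F (\<i> * of_real y)) \<le> exp (y\<^sup>2 / (2 * x\<^sup>2)) *
     (norm (f 0) * exp (Re (\<i> * of_real y * log_deriv f 0) - y\<^sup>2 / 2 * Re (deriv (log_deriv f) 0) + e))"
    unfolding norm_mult using bounded by (intro mult_mono) (auto simp: taylor_bounded_def)
  also have "\<dots> = norm (?F 0) * exp (Re (\<i> * of_real y * log_deriv ?F 0) - y\<^sup>2 / 2 * Re (deriv (log_deriv ?F) 0) + e)"
  proof -
    have "Re (deriv (log_deriv ?F) 0) = - 1 / x\<^sup>2 + Re (deriv (log_deriv f) 0)"
      unfolding 2 by (simp flip: of_real_power)
    moreover have "Re (\<i> * of_real y * log_deriv ?F 0) = Re (\<i> * of_real y * log_deriv f 0)"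
      unfolding 1 by simp
    ultimately have "y\<^sup>2 / (2 * x\<^sup>2) + (Re (\<i> * of_real y * log_deriv f 0) - y\<^sup>2 / 2 * Re (deriv (log_deriv f) 0) + e)
        = Re (\<i> * of_real y * log_deriv ?F 0) - y\<^sup>2 / 2 * Re (deriv (log_deriv ?F) 0) + e"
      by (simp only:) (simp add: algebra_simps)
    then show ?thesis by (simp only: exp_add[symmetric] mult.left_commute) simp
  qed
  finally show ?thesis unfolding taylor_bounded_def .
qed

text \<open>The error does not grow with the number of factors; this permits letting the radius of
  the disc tend to infinity, however many zeros are divided out.\<close>

lemma taylor_bounded_mult_linear_factors:
  assumes f: "f holomorphic_on UNIV" "f 0 \<noteq> 0" and "0 \<notin> set xs"
    and "taylor_bounded f y e"
  shows "taylor_bounded (\<lambda>z. (\<Prod>x\<leftarrow>xs. 1 - z / of_real x) * f z) y e"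
  using \<open>0 \<notin> set xs\<close>
proof (induction xs)
  case Nil
  then show ?case using assms(4) by simp
next
  case (Cons x xs)
  have "(\<lambda>z. (\<Prod>x\<leftarrow>xs. 1 - z / of_real x) * f z) holomorphic_on UNIV"
  proof (intro holomorphic_on_mult f)
    show "(\<lambda>z. \<Prod>x\<leftarrow>xs. 1 - z / of_real x) holomorphic_on UNIV"
      using Cons.prems by (induction xs) (auto intro!: holomorphic_intros)
  qed
  moreover have "(\<Prod>x\<leftarrow>xs. 1 - 0 / of_real x) * f 0 \<noteq> 0"
    using f by (induction xs) auto
  ultimately show ?case
    using taylor_bounded_mult_linear[of "\<lambda>z. (\<Prod>x\<leftarrow>xs. 1 - z / of_real x) * f z" x] Cons
    by (simp add: mult.assoc)
qed

section \<open>Dividing out real zeros\<close>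

text \<open>The local factor at a zero is glued to the quotient \<open>f z / (z - a) ^ n\<close>,
  which is holomorphic away from \<open>a\<close>; the two agree on the punctured disc. If
  \<open>f a\<close> is nonzero, \<open>n\<close> is taken to be 0.\<close>

lemma entire_factor_zero:
  assumes f: "f holomorphic_on UNIV" "\<exists>z. f z \<noteq> 0"
  obtains n g where "g holomorphic_on UNIV" "g a \<noteq> 0" "\<And>z. f z = (z - a) ^ n * g z"
proof (cases "f a = 0")
  case False
  then show thesis using that[of f 0] f by simp
next
  case True
  have "\<not> f constant_on UNIV"
    using f(2) True by (metis UNIV_I constant_on_def)
  then obtain g r n where n: "0 < n" and r: "0 < r" and g: "g holomorphic_on ball a r"
      "\<And>w. w \<in> ball a r \<Longrightarrow> f w = (w - a) ^ n * g w" "\<And>w. w \<in> ball a r \<Longrightarrow> g w \<noteq> 0"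
    using holomorphic_factor_zero_nonconstant[OF f(1) open_UNIV connected_UNIV UNIV_I True] by metis
  define G where "G z = (if z = a then g a else f z / (z - a) ^ n)" for z
  have G_g: "G z = g z" if "z \<in> ball a r" for z
    using g(2)[OF that] by (auto simp: G_def)
  show thesis
  proof
    have "G holomorphic_on ball a r"
      using g(1) by (rule holomorphic_transform) (simp add: G_g)
    moreover have "(\<lambda>z. f z / (z - a) ^ n) holomorphic_on - {a}"
      by (intro holomorphic_intros holomorphic_on_subset[OF f(1)]) auto
    then have "G holomorphic_on - {a}"
      by (rule holomorphic_transform) (simp add: G_def)
    ultimately have "G holomorphic_on ball a r \<union> - {a}"
      by (rule holomorphic_on_Un) auto
    then show "G holomorphic_on UNIV"
      by (rule holomorphic_on_subset) (use r in auto)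
    show "G a \<noteq> 0" using g(3)[of a] r by (simp add: G_def)
    show "f z = (z - a) ^ n * G z" for z using True n by (simp add: G_def)
  qed
qed

text \<open>Points are removed one at a time, and a list records multiplicities; a point of
  \<open>A\<close> that is not a zero contributes no entry. Normalising each factor to the value 1
  at 0 moves the constant \<open>(- of_real a) ^ n\<close> into the cofactor.\<close>

lemma entire_factor_real_zeros:
  fixes A :: "real set"
  assumes "finite A" "0 \<notin> A" and f: "f holomorphic_on UNIV" "f 0 \<noteq> 0"
  shows "\<exists>xs g. set xs \<subseteq> A \<and> g holomorphic_on UNIV \<and> (\<forall>x\<in>A. g (of_real x) \<noteq> 0) \<and>
           (\<forall>z. f z = (\<Prod>x\<leftarrow>xs. 1 - z / of_real x) * g z)"
  using assms(1,2)
proof (induction rule: finite_induct)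
  case empty
  show ?case using f by (intro exI[of _ "[]"] exI[of _ f]) auto
next
  case (insert a A)
  then obtain xs g where xs: "set xs \<subseteq> A" and g: "g holomorphic_on UNIV" "\<And>x. x \<in> A \<Longrightarrow> g (of_real x) \<noteq> 0"
    and fg: "\<And>z. f z = (\<Prod>x\<leftarrow>xs. 1 - z / of_real x) * g z"
    by auto
  have a: "a \<noteq> 0" using insert by auto
  have "g 0 \<noteq> 0" using fg[of 0] f(2) by auto
  then obtain n k where k: "k holomorphic_on UNIV" "k (of_real a) \<noteq> 0" "\<And>z. g z = (z - of_real a) ^ n * k z"
    using entire_factor_zero[OF g(1)] by metis
  let ?k = "\<lambda>z. (- of_real a) ^ n * k z"
  have "(z - of_real a) ^ n = (1 - z / of_real a) ^ n * (- of_real a) ^ n" for z :: complex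
    using a by (simp add: field_simps flip: power_mult_distrib)
  then have "f z = (\<Prod>x\<leftarrow>replicate n a @ xs. 1 - z / of_real x) * ?k z" for z
    using fg[of z] k(3)[of z] by (simp add: prod_list_replicate mult_ac)
  moreover have "?k (of_real x) \<noteq> 0" if "x \<in> insert a A" for x
    using that k a g(2) by auto
  moreover have "?k holomorphic_on UNIV" by (intro holomorphic_intros k)
  moreover have "set (replicate n a @ xs) \<subseteq> insert a A" using xs by auto
  ultimately show ?case by blast
qed

section \<open>Entire functions of order at most two with real zeros\<close>

text \<open>The growth constants \<open>B\<close> and \<open>C\<close> enter only through the error
  \<open>e R\<close>, which is O(1/R), and so disappear from the final bound. This matters for
  \<open>H\<close>, where \<open>B\<close> is not bounded uniformly.\<close>

lemma entire_real_zeros_imaginary_axis_bound: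
  assumes f: "f holomorphic_on UNIV" "f 0 \<noteq> 0" "deriv f 0 = 0"
    and growth: "\<And>z. norm (f z) \<le> C * exp (B * (norm z)\<^sup>2)"
    and real_zeros: "\<And>z. f z = 0 \<Longrightarrow> z \<in> \<real>"
  shows "norm (f (\<i> * of_real y)) \<le> norm (f 0) * exp (norm (deriv (deriv f) 0) / norm (f 0) * y\<^sup>2 / 2)"
proof -
  \<comment> \<open>Growth on the circle of radius 2 * R contributes
    \<open>4 * B * R\<^sup>2\<close>; the summand 1 makes the bound on the cofactor strict.\<close>
  define M where "M R = ln (C / norm (f 0)) + 4 * B * R\<^sup>2 + 1" for R :: real
  define e where "e R = 384 * M R * \<bar>y\<bar> ^ 3 / R ^ 3" for R
  have C: "norm (f 0) \<le> C" using growth[of 0] by simp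
  have C_pos: "0 < C" using C f(2) by (meson less_le_trans zero_less_norm_iff)
  have bounded: "taylor_bounded f y (e R)" if R: "4 * \<bar>y\<bar> + 1 \<le> R" for R
  proof -
    have R_pos: "0 < R" using R by simp
    define Z where "Z = {z \<in> cball 0 R. f z = 0}"
    have "finite Z"
    proof (cases "f constant_on UNIV")
      case True
      then have "Z = {}" using f(2) unfolding Z_def constant_on_def by force
      then show ?thesis by simp
    next
      case False
      then show ?thesis unfolding Z_def
        by (intro holomorphic_compact_finite_zeros[OF f(1)]) auto
    qed
    moreover have Z_real: "z = of_real (Re z)" if "z \<in> Z" for z
      using real_zeros[of z] that by (auto simp: Z_def of_real_Re)
    then have "0 \<notin> Re ` Z" using f(2) by (force simp: Z_def)
    ultimately obtain xs g where xs: "set xs \<subseteq> Re ` Z" and g: "g holomorphic_on UNIV"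
      and g_nz: "\<And>x. x \<in> Re ` Z \<Longrightarrow> g (of_real x) \<noteq> 0"
      and fg: "\<And>z. f z = (\<Prod>x\<leftarrow>xs. 1 - z / of_real x) * g z"
      using entire_factor_real_zeros[of "Re ` Z" f] f by blast
    have xs0: "0 \<notin> set xs" using xs \<open>0 \<notin> Re ` Z\<close> by blast
    have g0: "g 0 = f 0"
    proof -
      have "(\<Prod>x\<leftarrow>xs. 1 - 0 / complex_of_real x) = 1" by (induction xs) auto
      then show ?thesis using fg[of 0] by simp
    qed
    \<comment> \<open>A zero of \<open>g\<close> in the disc would be a zero of \<open>f\<close>,
      hence one of the points at which the cofactor was made nonzero.\<close>
    have g_nonzero: "g z \<noteq> 0" if "z \<in> ball 0 R" for z
    proof
      assume "g z = 0"
      then have "z \<in> Z" using fg[of z] that by (simp add: Z_def)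
      then show False using g_nz[of "Re z"] Z_real[of z] \<open>g z = 0\<close> by simp
    qed
    \<comment> \<open>The removed zeros satisfy |x| <= R, so on |z| = 2 * R every factor has modulus
      at least |z/x| - 1 >= 1, and dividing by it cannot increase the modulus of
      \<open>f\<close>.\<close>
    have g_sphere: "norm (g z) \<le> C * exp (4 * B * R\<^sup>2)" if z: "norm z = 2 * R" for z
    proof -
      have "1 \<le> norm (\<Prod>x\<leftarrow>xs. 1 - z / of_real x)"
        using xs xs0
      proof (induction xs)
        case (Cons x xs)
        have x: "x \<noteq> 0" "\<bar>x\<bar> \<le> R"
          using Cons.prems abs_Re_le_cmod order_trans by (auto simp: Z_def)
        have "2 \<le> norm (z / of_real x)"
          using x z R_pos by (simp add: norm_divide pos_le_divide_eq)
        then have "1 \<le> norm (1 - z / of_real x)"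
          using norm_triangle_ineq2[of "z / of_real x" 1] by (simp add: norm_minus_commute)
        moreover have "1 \<le> norm (\<Prod>x\<leftarrow>xs. 1 - z / of_real x)"
          using Cons by simp
        ultimately have "1 * 1 \<le> norm (1 - z / of_real x) * norm (\<Prod>x\<leftarrow>xs. 1 - z / of_real x)"
          by (intro mult_mono) auto
        then show ?case by (simp add: norm_mult)
      qed simp
      then have "norm (g z) \<le> norm (f z)"
        using mult_right_mono[of 1 "norm (\<Prod>x\<leftarrow>xs. 1 - z / of_real x)" "norm (g z)"]
        by (simp add: fg[of z] norm_mult)
      also have "\<dots> \<le> C * exp (4 * B * R\<^sup>2)"
        using growth[of z] z by (simp add: power_mult_distrib mult_ac)
      finally show ?thesis .
    qed
    have "norm (g z) < norm (g 0) * exp (M R)" if "z \<in> ball 0 R" for z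
    proof -
      \<comment> \<open>The maximum principle carries the bound from the circle into the disc, where
        the linear factors themselves may be small.\<close>
      have "norm (g z) \<le> C * exp (4 * B * R\<^sup>2)"
      proof (rule maximum_modulus_frontier[where f = g and \<xi> = z and S = "cball 0 (2 * R)"])
        show "g holomorphic_on interior (cball 0 (2 * R))" using g holomorphic_on_subset by blast
        show "continuous_on (closure (cball 0 (2 * R))) g"
          using holomorphic_on_imp_continuous_on[OF g] continuous_on_subset by blast
      qed (use that R_pos g_sphere in auto)
      also have "\<dots> < C * exp (4 * B * R\<^sup>2 + 1)"
        using C_pos by simp
      also have "\<dots> = norm (g 0) * exp (M R)"
        using C_pos f(2) by (simp add: M_def g0 exp_add)
      finally show ?thesis .
    qed
    then have "taylor_bounded g y (e R)"
      unfolding e_def using g g_nonzero R R_pos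
      by (intro taylor_bounded_nonvanishing) (auto intro: holomorphic_on_subset)
    then have "taylor_bounded (\<lambda>z. (\<Prod>x\<leftarrow>xs. 1 - z / of_real x) * g z) y (e R)"
      using g g0 f(2) xs0 by (intro taylor_bounded_mult_linear_factors) auto
    then show ?thesis using fg by presburger
  qed
  have d2: "deriv (log_deriv f) 0 = deriv (deriv f) 0 / f 0"
  proof -
    have df: "(f has_field_derivative deriv f 0) (at 0)"
      using holomorphic_derivI[OF f(1)] by simp
    have "((\<lambda>z. deriv f z / f z) has_field_derivative (deriv (deriv f) 0 * f 0 - deriv f 0 * deriv f 0) / (f 0 * f 0)) (at 0)"
      using holomorphic_derivI[OF holomorphic_deriv[OF f(1)]] f(2)
      by (intro DERIV_divide df) auto
    then show ?thesis
      unfolding log_deriv_def[abs_def] using f(2,3) by (auto dest!: DERIV_imp_deriv)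
  qed
  define a where "a = norm (deriv (deriv f) 0) / norm (f 0) * y\<^sup>2 / 2"
  have le: "norm (f (\<i> * of_real y)) \<le> norm (f 0) * exp (a + e R)" if "4 * \<bar>y\<bar> + 1 \<le> R" for R
  proof -
    have "- Re (deriv (log_deriv f) 0) \<le> norm (deriv (deriv f) 0) / norm (f 0)"
      using abs_Re_le_cmod[of "deriv (log_deriv f) 0"] by (simp add: d2 norm_divide)
    then have "y\<^sup>2 / 2 * - Re (deriv (log_deriv f) 0) \<le> y\<^sup>2 / 2 * (norm (deriv (deriv f) 0) / norm (f 0))"
      by (intro mult_left_mono) auto
    then have "Re (\<i> * of_real y * log_deriv f 0) - y\<^sup>2 / 2 * Re (deriv (log_deriv f) 0) + e R \<le> a + e R"
      using f(3) by (simp add: log_deriv_def a_def mult_ac)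
    then have "norm (f 0) * exp (Re (\<i> * of_real y * log_deriv f 0) - y\<^sup>2 / 2 * Re (deriv (log_deriv f) 0) + e R)
        \<le> norm (f 0) * exp (a + e R)"
      by (intro mult_left_mono) auto
    then show ?thesis using bounded[OF that] unfolding taylor_bounded_def by linarith
  qed
  have "(e \<longlongrightarrow> 0) at_top"
  proof -
    \<comment> \<open>\<open>M R\<close> is quadratic in \<open>R\<close> against a cubic
      denominator; the rewriting of \<open>e R\<close> is valid for R > 0, hence eventually.\<close>
    have "((\<lambda>R. (384 * \<bar>y\<bar> ^ 3) * ((ln (C / norm (f 0)) + 1) / R ^ 3 + 4 * B / R)) \<longlongrightarrow> (384 * \<bar>y\<bar> ^ 3) * (0 + 0)) at_top"
      by (intro tendsto_mult_left tendsto_add) real_asymp+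
    moreover have "eventually (\<lambda>R. (384 * \<bar>y\<bar> ^ 3) * ((ln (C / norm (f 0)) + 1) / R ^ 3 + 4 * B / R) = e R) at_top"
      using eventually_gt_at_top[of 0]
      by eventually_elim (simp add: e_def M_def field_simps eval_nat_numeral)
    ultimately show ?thesis by (simp add: tendsto_cong)
  qed
  then have "((\<lambda>R. norm (f 0) * exp (a + e R)) \<longlongrightarrow> norm (f 0) * exp (a + 0)) at_top"
    by (intro tendsto_intros)
  then have "norm (f (\<i> * of_real y)) \<le> norm (f 0) * exp (a + 0)"
    by (rule tendsto_lowerbound[OF _ eventually_mono[OF eventually_ge_at_top le]]) auto
  then show ?thesis by (simp add: a_def)
qed

section \<open>Gaussian averaging\<close>

lemma nn_integral_gaussian:
  assumes "0 < (c::real)"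
  shows "(\<integral>\<^sup>+x. ennreal (exp (- c * x\<^sup>2)) \<partial>lborel) = ennreal (sqrt (pi / c))"
proof -
  \<comment> \<open>\<open>exp (- c * x\<^sup>2)\<close> is a multiple of the centred normal density
    of variance 1 / (2 * c).\<close>
  define \<sigma> where "\<sigma> = 1 / sqrt (2 * c)"
  have \<sigma>: "0 < \<sigma>" "\<sigma>\<^sup>2 = 1 / (2 * c)" using assms by (auto simp: \<sigma>_def power_divide)
  have eq: "exp (- c * x\<^sup>2) = sqrt (pi / c) * normal_density 0 \<sigma> x" for x
    using assms by (simp add: normal_density_def \<sigma>(2) real_sqrt_divide field_simps)
  have "(\<integral>\<^sup>+x. ennreal (exp (- c * x\<^sup>2)) \<partial>lborel) = ennreal (\<integral>x. exp (- c * x\<^sup>2) \<partial>lborel)"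
    unfolding eq using assms \<sigma>(1) by (intro nn_integral_eq_integral) auto
  also have "(\<integral>x. exp (- c * x\<^sup>2) \<partial>lborel) = sqrt (pi / c)"
    unfolding eq using \<sigma>(1) by simp
  finally show ?thesis .
qed

text \<open>Integrating exp (- c * y^2 - y * t) over y gives a multiple of exp (t^2 / (4 * c)),
  which is the gain in the exponent. By Tonelli the same double integral is dominated by a Gaussian
  integral of rate \<open>c - A\<close>, which is positive.\<close>

lemma exp_square_integrable_of_subgaussian:
  fixes \<rho> :: "real measure"
  assumes "real_distribution \<rho>"
    and int: "\<And>y. integrable \<rho> (\<lambda>t. exp (- y * t) * exp (l * t\<^sup>2))"
    and bound: "\<And>y. (\<integral>t. exp (- y * t) * exp (l * t\<^sup>2) \<partial>\<rho>) \<le> D * exp (A * y\<^sup>2)"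
    and c: "0 < c" "A < c"
  shows "l + 1 / (4 * c) \<in> T_set \<rho>"
proof -
  interpret real_distribution \<rho> by fact
  interpret pair_sigma_finite \<rho> lborel ..
  let ?b = "l + 1 / (4 * c)"
  let ?F = "\<lambda>t y. ennreal (exp (- c * y\<^sup>2) * (exp (- y * t) * exp (l * t\<^sup>2)))"
  have D: "0 \<le> D"
    using order_trans[OF integral_nonneg_AE bound[of 0]] by simp
  have shift: "(\<integral>\<^sup>+y. ?F t y \<partial>lborel) = ennreal (exp (?b * t\<^sup>2)) * ennreal (sqrt (pi / c))" for t
  proof -
    \<comment> \<open>Completing the square in \<open>y\<close>; the form
      \<open>t / (2 * c) + 1 * y\<close> fits the affine substitution rule used below.\<close>
    have "- c * y\<^sup>2 + (- y * t + l * t\<^sup>2) = ?b * t\<^sup>2 + - c * (t / (2 * c) + 1 * y)\<^sup>2" for y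
      using c by (simp add: power2_eq_square field_simps)
    then have "(\<integral>\<^sup>+y. ?F t y \<partial>lborel) =
        (\<integral>\<^sup>+y. ennreal (exp (?b * t\<^sup>2)) * ennreal (exp (- c * (t / (2 * c) + 1 * y)\<^sup>2)) \<partial>lborel)"
      by (simp only: exp_add[symmetric] ennreal_mult'[symmetric] exp_ge_zero)
    also have "\<dots> = ennreal (exp (?b * t\<^sup>2)) * (\<integral>\<^sup>+y. ennreal (exp (- c * (t / (2 * c) + 1 * y)\<^sup>2)) \<partial>lborel)"
      by (rule nn_integral_cmult) simp
    also have "(\<integral>\<^sup>+y. ennreal (exp (- c * (t / (2 * c) + 1 * y)\<^sup>2)) \<partial>lborel) = ennreal (sqrt (pi / c))"
      using nn_integral_real_affine[where f = "\<lambda>y. ennreal (exp (- c * y\<^sup>2))" and c = 1 and t = "t / (2 * c)"]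
        nn_integral_gaussian[OF c(1)] by simp
    finally show ?thesis .
  qed
  have inner: "(\<integral>\<^sup>+t. ?F t y \<partial>\<rho>) \<le> ennreal D * ennreal (exp (- (c - A) * y\<^sup>2))" for y
  proof -
    have "(\<integral>\<^sup>+t. ?F t y \<partial>\<rho>) = ennreal (exp (- c * y\<^sup>2) * (\<integral>t. exp (- y * t) * exp (l * t\<^sup>2) \<partial>\<rho>))"
      by (subst nn_integral_eq_integral) (auto intro: int[simplified])
    also have "\<dots> \<le> ennreal (exp (- c * y\<^sup>2) * (D * exp (A * y\<^sup>2)))"
      by (intro ennreal_leI mult_left_mono bound) auto
    also have "exp (- c * y\<^sup>2) * (D * exp (A * y\<^sup>2)) = D * exp (- (c - A) * y\<^sup>2)"
      by (simp add: algebra_simps flip: exp_add)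
    finally show ?thesis using D by (simp add: ennreal_mult')
  qed
  have "(\<integral>\<^sup>+t. ennreal (exp (?b * t\<^sup>2)) \<partial>\<rho>) * ennreal (sqrt (pi / c)) = (\<integral>\<^sup>+t. \<integral>\<^sup>+y. ?F t y \<partial>lborel \<partial>\<rho>)"
    unfolding shift by (rule nn_integral_multc[symmetric]) simp
  also have "\<dots> = (\<integral>\<^sup>+y. \<integral>\<^sup>+t. ?F t y \<partial>\<rho> \<partial>lborel)"
    by (rule Fubini'[symmetric]) simp
  also have "\<dots> \<le> (\<integral>\<^sup>+y. ennreal D * ennreal (exp (- (c - A) * y\<^sup>2)) \<partial>lborel)"
    by (intro nn_integral_mono inner)
  also have "\<dots> = ennreal D * ennreal (sqrt (pi / (c - A)))"
    using c nn_integral_gaussian[of "c - A"] by (subst nn_integral_cmult) auto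
  also have "\<dots> < \<infinity>" by (simp add: ennreal_mult_less_top)
  finally have "(\<integral>\<^sup>+t. ennreal (exp (?b * t\<^sup>2)) \<partial>\<rho>) < \<infinity>"
    using c by (auto simp: ennreal_mult_less_top)
  then show ?thesis by (simp add: T_set_def)
qed

section \<open>Growth and symmetry of \<open>H\<close>\<close>

text \<open>Serves to absorb the linear exponent |z| * |t| of the integrand of \<open>H\<close> into
  a small multiple of t^2, at the price of a quadratic term in |z|.\<close>

lemma young_quadratic:
  assumes "0 < (d::real)"
  shows "n * a \<le> d * a\<^sup>2 + 1 / (4 * d) * n\<^sup>2"
proof -
  have "d * a\<^sup>2 + 1 / (4 * d) * n\<^sup>2 - n * a = (2 * d * a - n)\<^sup>2 / (4 * d)"
    using assms by (simp add: field_simps power2_eq_square)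
  also have "\<dots> \<ge> 0" using assms by simp
  finally show ?thesis by simp
qed

lemma integrable_exp_square:
  assumes "real_distribution \<rho>" "b \<in> T_set \<rho>"
  shows "integrable \<rho> (\<lambda>t. exp (b * t\<^sup>2))"
proof -
  interpret real_distribution \<rho> by fact
  show ?thesis
    using assms(2) by (intro integrableI_nonneg) (auto simp: T_set_def)
qed

text \<open>On the imaginary axis \<open>H\<close> is a two-sided Laplace transform. The equation
  holds even without integrability, when both integrals are 0 by default.\<close>

lemma H_imaginary_axis:
  "H \<rho> l (\<i> * of_real y) = of_real (\<integral>t. exp (- y * t) * exp (l * t\<^sup>2) \<partial>\<rho>)"
proof -
  have "H_integrand l (\<i> * of_real y) = (\<lambda>t. of_real (exp (- y * t) * exp (l * t\<^sup>2)))"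
    by (auto simp: H_integrand_def fun_eq_iff exp_of_real[symmetric] mult_ac)
  then show ?thesis by (simp only: H_def integral_complex_of_real)
qed

lemma norm_H_integrand: "norm (H_integrand l z t) = exp (- Im z * t) * exp (l * t\<^sup>2)"
  by (simp add: H_integrand_def norm_mult)

lemma integrable_of_H_entire:
  assumes "H_entire \<rho> l"
  shows "integrable \<rho> (\<lambda>t. exp (- y * t) * exp (l * t\<^sup>2))"
proof -
  have "integrable \<rho> (\<lambda>t. norm (H_integrand l (\<i> * of_real y) t))"
    using assms by (intro integrable_norm) (auto simp: H_entire_def)
  then show ?thesis by (simp add: norm_H_integrand)
qed

lemma norm_H_le:
  assumes "H_entire \<rho> l" "integrable \<rho> g" "\<And>t. norm (H_integrand l z t) \<le> g t"
  shows "norm (H \<rho> l z) \<le> (\<integral>t. g t \<partial>\<rho>)"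
  unfolding H_def using assms by (intro Bochner_Integration.integral_norm_bound_integral) (auto simp: H_entire_def)

lemma H_even:
  assumes "even_prob_measure \<rho>"
  shows "H \<rho> l (- z) = H \<rho> l z"
proof -
  interpret real_distribution \<rho> using assms by (simp add: even_prob_measure_def)
  have meas: "H_integrand l w \<in> borel_measurable borel" for w
    unfolding H_integrand_def[abs_def] by measurable
  have "H \<rho> l z = integral\<^sup>L (distr \<rho> borel uminus) (H_integrand l z)"
    using assms by (simp add: H_def even_prob_measure_def)
  also have "\<dots> = (\<integral>t. H_integrand l z (- t) \<partial>\<rho>)"
    by (rule integral_distr) (use meas in auto)
  also have "\<dots> = H \<rho> l (- z)"
    by (simp add: H_def H_integrand_def)
  finally show ?thesis by simp
qed

section \<open>The contradiction at the endpoint\<close>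

text \<open>The growth constant 1 / (4 * (b0 - l)) blows up as l approaches b0, but the bound on the
  imaginary axis sees only the value and second derivative at 0, which are controlled uniformly. The
  Gaussian gain therefore stays fixed while l moves up to b0, and their sum passes the maximum of
  \<open>T_set \<rho>\<close>.\<close>

lemma P_set_excludes_interval_at_T_set_max:
  assumes \<rho>: "even_prob_measure \<rho>" and T: "T_set \<rho> = {..b\<^sub>0}"
    and l\<^sub>0: "l\<^sub>0 < b\<^sub>0" and P: "{l\<^sub>0..b\<^sub>0} \<subseteq> P_set \<rho>"
  shows False
proof -
  have dist: "real_distribution \<rho>" using \<rho> by (simp add: even_prob_measure_def)
  interpret real_distribution \<rho> by fact
  have int_T: "integrable \<rho> (\<lambda>t. exp (l * t\<^sup>2))" if "l \<le> b\<^sub>0" for l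
    using integrable_exp_square[OF dist] T that by simp
  have entire: "H_entire \<rho> l" if "l\<^sub>0 \<le> l" "l \<le> b\<^sub>0" for l
    using P that by (auto simp: P_set_def)
  have zeros: "z \<in> \<real>" if "l\<^sub>0 \<le> l" "l \<le> b\<^sub>0" "H \<rho> l z = 0" for l z
    using P that by (auto simp: P_set_def)
  define m where "m l = (\<integral>t. exp (l * t\<^sup>2) \<partial>\<rho>)" for l
  have H0: "H \<rho> l 0 = of_real (m l)" for l
    using H_imaginary_axis[of \<rho> l 0] by (simp add: m_def)
  have m_mono: "m l \<le> m l'" if "l \<le> l'" "l' \<le> b\<^sub>0" for l l'
    unfolding m_def using that
    by (intro Bochner_Integration.integral_mono int_T) (auto intro: mult_right_mono)
  have "0 < m l\<^sub>0"
  proof -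
    have "m l\<^sub>0 \<noteq> 0"
    proof
      assume "m l\<^sub>0 = 0"
      then have "AE t in \<rho>. exp (l\<^sub>0 * t\<^sup>2) = 0"
        unfolding m_def using int_T[of l\<^sub>0] l\<^sub>0 by (subst (asm) integral_nonneg_eq_0_iff_AE) auto
      then show False by simp
    qed
    moreover have "0 \<le> m l\<^sub>0" unfolding m_def by (intro integral_nonneg_AE) auto
    ultimately show ?thesis by simp
  qed
  \<comment> \<open>The integral of 2 * cosh t * exp (b0 * t^2), convergent because
    \<open>H_entire\<close> holds at the endpoint itself; it bounds \<open>H \<rho> l\<close> on the
    unit circle for every \<open>l\<close> considered.\<close>
  define K where "K = (\<integral>t. exp (- 1 * t) * exp (b\<^sub>0 * t\<^sup>2) + exp (- (- 1) * t) * exp (b\<^sub>0 * t\<^sup>2) \<partial>\<rho>)"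
  \<comment> \<open>Cauchy's inequality on the unit circle bounds the second derivative at 0 by 2 *
    K, and \<open>H \<rho> l 0\<close> is at least \<open>m l\<^sub>0\<close>; \<open>A\<close>
    dominates half the quotient.\<close>
  define A where "A = K / m l\<^sub>0"
  have int_K: "integrable \<rho> (\<lambda>t. exp (- 1 * t) * exp (b\<^sub>0 * t\<^sup>2) + exp (- (- 1) * t) * exp (b\<^sub>0 * t\<^sup>2))"
    using entire[of b\<^sub>0] l\<^sub>0 by (intro Bochner_Integration.integrable_add integrable_of_H_entire) auto
  have "0 \<le> K" unfolding K_def by (intro integral_nonneg_AE) auto
  then have A: "0 \<le> A" using \<open>0 < m l\<^sub>0\<close> by (simp add: A_def)
  have bound: "(\<integral>t. exp (- y * t) * exp (l * t\<^sup>2) \<partial>\<rho>) \<le> m b\<^sub>0 * exp (A * y\<^sup>2)"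
    if l: "l\<^sub>0 \<le> l" "l < b\<^sub>0" for l y
  proof -
    have hol: "H \<rho> l holomorphic_on UNIV" using entire[of l] l by (simp add: H_entire_def)
    have m_l: "m l\<^sub>0 \<le> m l" "m l \<le> m b\<^sub>0" using m_mono l by auto
    \<comment> \<open>Evenness of \<open>H \<rho> l\<close> makes this derivative equal to its own
      negative.\<close>
    have deriv_0: "deriv (H \<rho> l) 0 = 0"
    proof -
      have d: "(H \<rho> l has_field_derivative deriv (H \<rho> l) z) (at z)" for z
        using holomorphic_derivI[OF hol] by simp
      have "((\<lambda>z. H \<rho> l (- z)) has_field_derivative deriv (H \<rho> l) (- 0) * - 1) (at 0)"
        by (rule DERIV_chain2[OF d]) (auto intro!: derivative_eq_intros)
      then have "(H \<rho> l has_field_derivative - deriv (H \<rho> l) 0) (at 0)"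
        by (simp add: H_even[OF \<rho>])
      then have "deriv (H \<rho> l) 0 = - deriv (H \<rho> l) 0" by (rule DERIV_imp_deriv)
      then show ?thesis by simp
    qed
    \<comment> \<open>The gap \<open>b\<^sub>0 - l\<close> serves as the weight \<open>d\<close> in
      \<open>young_quadratic\<close>, leaving exp (b0 * t^2), which is integrable.\<close>
    have growth: "norm (H \<rho> l z) \<le> m b\<^sub>0 * exp (1 / (4 * (b\<^sub>0 - l)) * (norm z)\<^sup>2)" for z
    proof -
      let ?E = "exp (1 / (4 * (b\<^sub>0 - l)) * (norm z)\<^sup>2)"
      have "norm (H \<rho> l z) \<le> (\<integral>t. exp (b\<^sub>0 * t\<^sup>2) * ?E \<partial>\<rho>)"
      proof (rule norm_H_le)
        fix t
        have "- Im z * t \<le> norm z * \<bar>t\<bar>"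
          using mult_right_mono[OF abs_Im_le_cmod[of z], of "\<bar>t\<bar>"] abs_ge_self[of "- Im z * t"]
          by (simp add: abs_mult)
        also have "\<dots> \<le> (b\<^sub>0 - l) * t\<^sup>2 + 1 / (4 * (b\<^sub>0 - l)) * (norm z)\<^sup>2"
          using young_quadratic[of "b\<^sub>0 - l" "norm z" "\<bar>t\<bar>"] l by simp
        finally have "- Im z * t + l * t\<^sup>2 \<le> b\<^sub>0 * t\<^sup>2 + 1 / (4 * (b\<^sub>0 - l)) * (norm z)\<^sup>2"
          by (simp add: algebra_simps)
        then show "norm (H_integrand l z t) \<le> exp (b\<^sub>0 * t\<^sup>2) * ?E"
          unfolding norm_H_integrand exp_add[symmetric] exp_le_cancel_iff .
      qed (use entire[of l] l int_T in auto)
      then show ?thesis by (simp add: m_def)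
    qed
    have K: "norm (H \<rho> l z) \<le> K" if z: "norm (0 - z) = 1" for z
      unfolding K_def
    proof (rule norm_H_le[OF entire int_K])
      fix t
      have Im: "\<bar>Im z\<bar> \<le> 1" using abs_Im_le_cmod[of z] z by simp
      have "- Im z * t \<le> \<bar>t\<bar>"
        using mult_right_mono[OF Im, of "\<bar>t\<bar>"] abs_ge_self[of "- Im z * t"] by (simp add: abs_mult)
      then have "exp (- Im z * t) \<le> exp \<bar>t\<bar>" by simp
      also have "\<dots> \<le> exp (- 1 * t) + exp (- (- 1) * t)" by (cases "0 \<le> t") auto
      finally have "exp (- Im z * t) \<le> exp (- 1 * t) + exp (- (- 1) * t)" .
      moreover have "exp (l * t\<^sup>2) \<le> exp (b\<^sub>0 * t\<^sup>2)" using l by (simp add: mult_right_mono)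
      ultimately have "exp (- Im z * t) * exp (l * t\<^sup>2) \<le> (exp (- 1 * t) + exp (- (- 1) * t)) * exp (b\<^sub>0 * t\<^sup>2)"
        by (intro mult_mono) auto
      then show "norm (H_integrand l z t) \<le> exp (- 1 * t) * exp (b\<^sub>0 * t\<^sup>2) + exp (- (- 1) * t) * exp (b\<^sub>0 * t\<^sup>2)"
        by (simp add: norm_H_integrand algebra_simps)
    qed (use l in auto)
    have "norm ((deriv ^^ 2) (H \<rho> l) 0) \<le> fact 2 * K / 1 ^ 2"
      by (rule Cauchy_inequality)
         (use K hol holomorphic_on_subset[OF hol] holomorphic_on_imp_continuous_on in auto)
    then have deriv2: "norm (deriv (deriv (H \<rho> l)) 0) \<le> 2 * K"
      by (simp add: numeral_2_eq_2)
    have "norm (H \<rho> l (\<i> * of_real y)) \<le> norm (H \<rho> l 0) *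
        exp (norm (deriv (deriv (H \<rho> l)) 0) / norm (H \<rho> l 0) * y\<^sup>2 / 2)"
      by (rule entire_real_zeros_imaginary_axis_bound[OF hol _ deriv_0 growth])
         (use zeros[of l] l m_l \<open>0 < m l\<^sub>0\<close> in \<open>auto simp: H0\<close>)
    also have "\<dots> \<le> m b\<^sub>0 * exp (A * y\<^sup>2)"
    proof (rule mult_mono)
      have "norm (deriv (deriv (H \<rho> l)) 0) / norm (H \<rho> l 0) \<le> 2 * K / m l\<^sub>0"
        using deriv2 m_l \<open>0 < m l\<^sub>0\<close> \<open>0 \<le> K\<close> by (intro frac_le) (auto simp: H0)
      then have "norm (deriv (deriv (H \<rho> l)) 0) / norm (H \<rho> l 0) * (y\<^sup>2 / 2) \<le> 2 * K / m l\<^sub>0 * (y\<^sup>2 / 2)"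
        by (rule mult_right_mono) simp
      then show "exp (norm (deriv (deriv (H \<rho> l)) 0) / norm (H \<rho> l 0) * y\<^sup>2 / 2) \<le> exp (A * y\<^sup>2)"
        by (simp add: A_def)
    qed (use m_l \<open>0 < m l\<^sub>0\<close> in \<open>auto simp: H0\<close>)
    finally have "norm (H \<rho> l (\<i> * of_real y)) \<le> m b\<^sub>0 * exp (A * y\<^sup>2)" .
    then show ?thesis unfolding H_imaginary_axis norm_of_real by linarith
  qed
  \<comment> \<open>With c = A + 1 the gain is 1 / (4 * (A + 1)), twice the largest distance from
    \<open>l\<close> to \<open>b\<^sub>0\<close> allowed here; the maximum with
    \<open>l\<^sub>0\<close> keeps \<open>l\<close> in the interval where zeros are real.\<close>
  define l where "l = max l\<^sub>0 (b\<^sub>0 - 1 / (8 * (A + 1)))"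
  have l: "l\<^sub>0 \<le> l" "l < b\<^sub>0" using l\<^sub>0 A by (auto simp: l_def)
  have "l + 1 / (4 * (A + 1)) \<in> T_set \<rho>"
    by (rule exp_square_integrable_of_subgaussian[OF dist integrable_of_H_entire bound])
       (use l A entire[of l] in auto)
  moreover have "b\<^sub>0 < l + 1 / (4 * (A + 1))"
  proof -
    have "1 / (8 * (A + 1)) < 1 / (4 * (A + 1))" using A by (intro divide_strict_left_mono) auto
    then show ?thesis unfolding l_def by linarith
  qed
  ultimately show False using T by simp
qed

theorem mainTheorem2:
  fixes b\<^sub>0 :: real
  assumes "0 \<le> b\<^sub>0"
  shows "\<not> (\<exists>\<rho>. even_prob_measure \<rho> \<and> T_set \<rho> = {..b\<^sub>0} \<and>
           (P_set \<rho> = {..b\<^sub>0} \<or> (\<exists>\<Lambda>\<^sub>0<b\<^sub>0. P_set \<rho> = {\<Lambda>\<^sub>0..b\<^sub>0})))"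
proof
  assume "\<exists>\<rho>. even_prob_measure \<rho> \<and> T_set \<rho> = {..b\<^sub>0} \<and>
           (P_set \<rho> = {..b\<^sub>0} \<or> (\<exists>\<Lambda>\<^sub>0<b\<^sub>0. P_set \<rho> = {\<Lambda>\<^sub>0..b\<^sub>0}))"
  then obtain \<rho> where \<rho>: "even_prob_measure \<rho>" "T_set \<rho> = {..b\<^sub>0}"
    and P: "P_set \<rho> = {..b\<^sub>0} \<or> (\<exists>\<Lambda>\<^sub>0<b\<^sub>0. P_set \<rho> = {\<Lambda>\<^sub>0..b\<^sub>0})"
    by blast
  \<comment> \<open>Both alternatives leave a nondegenerate interval ending at
    \<open>b\<^sub>0\<close>; for the half-line any left end below \<open>b\<^sub>0\<close> would
    do.\<close>
  from P obtain l where "l < b\<^sub>0" "{l..b\<^sub>0} \<subseteq> P_set \<rho>"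
  proof (elim disjE exE conjE)
    assume P_eq: "P_set \<rho> = {..b\<^sub>0}"
    show thesis by (rule that[of "b\<^sub>0 - 1"]) (simp_all add: P_eq)
  next
    fix \<Lambda>\<^sub>0 assume "\<Lambda>\<^sub>0 < b\<^sub>0" "P_set \<rho> = {\<Lambda>\<^sub>0..b\<^sub>0}"
    then show thesis by (intro that[of \<Lambda>\<^sub>0]) simp_all
  qed
  then show False by (rule P_set_excludes_interval_at_T_set_max[OF \<rho>])
qed

end
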